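(* Let $n\ge 1$ and $N\ge 1$ be integers, and let $\zeta(N)$ be the worst-case fixed point residual of the proximal point algorithm after $N$ iterations on $\mathbb{R}^n$, i.e. $$\zeta(N)=\sup\left\{\frac{\|w^N-w^{N+1}\|^2}{\|w^0-w^*\|^2}\right\},$$ where the supremum is over all maximal monotone operators $A$ on $\mathbb{R}^n$ with $A^{-1}(0)\neq\emptyset$, all $\lambda>0$, all $w^*\in\mathbb{R}^n$ with $0\in A(w^* )$, and all $w^0\in\mathbb{R}^n$ with $w^0\neq w^*$, and where $w^{k+1}=J_{\lambda A}(w^k)$ for $k=0,1,\ldots,N$. Then for every $n\ge 1$ and every $N\ge 1$, $$\zeta(N)\le \frac{1}{\left(1+\frac1N\right)^N}\,\frac{1}{N+1},$$ and for every $n\ge 2$ and every $N\ge 1$ equality holds: $$\zeta(N)=\frac{1}{\left(1+\frac1N\right)^N}\,\frac{1}{N+1}.$$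
   Context: $\mathbb{R}^n$ carries an inner product $\langle\cdot,\cdot\rangle$ with induced norm $\|\cdot\|$. A set-valued operator $A$ on $\mathbb{R}^n$ is monotone if $\langle x-x',y-y'\rangle\ge 0$ whenever $y\in A(x)$ and $y'\in A(x')$; it is maximal monotone if its graph $\{(x,y)\in\mathbb{R}^n\times\mathbb{R}^n: y\in A(x)\}$ is not properly contained in the graph of another monotone operator. $A^{-1}(0)=\{w: 0\in A(w)\}$ is the set of zeros of $A$. For $\lambda>0$, the resolvent is $J_{\lambda A}=(I+\lambda A)^{-1}$, where $I$ is the identity; for maximal monotone $A$ it is single-valued and defined on all of $\mathbb{R}^n$ (Minty's theorem). *)

theory Defs
  imports "HOL-Analysis.Analysis"
begin

text \<open>Set-valued operators on a space are functions \<^typ>\<open>'a \<Rightarrow> 'a set\<close>.\<close>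

definition op_graph :: "('a \<Rightarrow> 'a set) \<Rightarrow> ('a \<times> 'a) set" where
  "op_graph A = {(x, y). y \<in> A x}"

definition monotone_op :: "('a::real_inner \<Rightarrow> 'a set) \<Rightarrow> bool" where
  "monotone_op A \<longleftrightarrow>
     (\<forall>x x' y y'. y \<in> A x \<longrightarrow> y' \<in> A x' \<longrightarrow> inner (x - x') (y - y') \<ge> 0)"

definition maximal_monotone_op :: "('a::real_inner \<Rightarrow> 'a set) \<Rightarrow> bool" where
  "maximal_monotone_op A \<longleftrightarrow>
     monotone_op A \<and> (\<forall>B. monotone_op B \<longrightarrow> \<not> op_graph A \<subset> op_graph B)"

definition op_inverse :: "('a \<Rightarrow> 'a set) \<Rightarrow> 'a \<Rightarrow> 'a set" where
  "op_inverse A y = {x. y \<in> A x}"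

definition resolvent :: "real \<Rightarrow> ('a::real_vector \<Rightarrow> 'a set) \<Rightarrow> 'a \<Rightarrow> 'a set" where
  "resolvent c A = op_inverse (\<lambda>x. {x + c *\<^sub>R u | u. u \<in> A x})"

text \<open>The resolvent is a set-valued operator here, so a value \<open>v\<close> of the single-valued
  resolvent at \<open>x\<close> appears as \<^term>\<open>resolvent c A x = {v}\<close>.  Only the entries
  \<open>w 0, \<dots>, w (N + 1)\<close> of the sequence are constrained.\<close>

definition ppa_iterates ::
    "real \<Rightarrow> ('a::real_vector \<Rightarrow> 'a set) \<Rightarrow> nat \<Rightarrow> (nat \<Rightarrow> 'a) \<Rightarrow> bool" where
  "ppa_iterates c A N w \<longleftrightarrow> (\<forall>k\<le>N. resolvent c A (w k) = {w (Suc k)})"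

text \<open>The supremum is taken in the extended reals, so that an upper bound on it really
  bounds every ratio (on \<^typ>\<open>real\<close>, \<^const>\<open>Sup\<close> of an unbounded set is
  unspecified).  The type argument supplies the space.\<close>

definition worst_case_residual :: "'a::euclidean_space itself \<Rightarrow> nat \<Rightarrow> ereal" where
  "worst_case_residual _ N =
     Sup {ereal ((norm (w N - w (Suc N)))\<^sup>2 / (norm (w 0 - ws))\<^sup>2) | A c ws (w :: nat \<Rightarrow> 'a).
            maximal_monotone_op A \<and> op_inverse A 0 \<noteq> {} \<and> c > 0 \<and> 0 \<in> A ws \<and>
            w 0 \<noteq> ws \<and> ppa_iterates c A N w}"

end

theory Submission
  imports Defs
begin

text \<open>Upper bound: with the zero translated to the origin and \<open>p = N / (N + 1)\<close>, the quantity
  \<open>((k + 1) |w\<^sub>k|\<^sup>2 - 2 k \<langle>w\<^sub>k, w\<^sub>k\<^sub>+\<^sub>1\<rangle> + k (2 p - 1) / p |w\<^sub>k\<^sub>+\<^sub>1|\<^sup>2) / p ^ k\<close> equals \<open>|w\<^sub>0|\<^sup>2\<close> at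
  \<open>k = 0\<close>, does not increase as long as \<open>k \<le> N\<close>, and at \<open>k = N\<close> is at least
  \<open>(N + 1) |w\<^sub>N - w\<^sub>N\<^sub>+\<^sub>1|\<^sup>2 / p ^ N\<close>.  Its decrease is a combination with nonnegative coefficients of
  the monotonicity inequality for consecutive iterates, of the one for an iterate and the zero,
  and of the square of \<open>w\<^sub>k\<^sub>+\<^sub>1 - p (2 w\<^sub>k - w\<^sub>k\<^sub>-\<^sub>1)\<close>, which vanishes on the extremal trajectories.
  These come from \<open>1 / \<surd>N\<close> times the rotation by a right angle in a plane: each resolvent step
  rotates and multiplies the squared norm by \<open>p\<close>.\<close>

definition ppa_potential :: "real \<Rightarrow> nat \<Rightarrow> 'a::real_inner \<Rightarrow> 'a \<Rightarrow> real" where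
  "ppa_potential p k x y =
     ((real k + 1) * inner x x - 2 * real k * inner x y
        + real k * (2 * p - 1) / p * inner y y) / p ^ k"

text \<open>Here \<open>a\<close>, \<open>b\<close>, \<open>d\<close> stand for three consecutive
  iterates, the zero being at the origin. Both sides are quadratic forms in them, so comparing
  coefficients suffices; \<open>p ^ Suc k\<close> clears the powers of \<open>p\<close> in the
  potential.\<close>

lemma ppa_potential_diff:
  fixes a b d :: "'a::real_inner"
  assumes p: "p > 0"
  shows "p ^ Suc k * (ppa_potential p k a b - ppa_potential p (Suc k) b d) =
      real (Suc k) / p * (norm (d - p *\<^sub>R (2 *\<^sub>R b - a)))\<^sup>2
    + 2 * real (Suc k) * inner (b - d) ((a - b) - (b - d))
    + 2 * (p * (real k + 2) - (real k + 1)) * inner b (a - b)"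
proof -
  have "p ^ Suc k * ppa_potential p k a b =
      p * (real k + 1) * inner a a - 2 * p * real k * inner a b + real k * (2 * p - 1) * inner b b"
    using p by (simp add: ppa_potential_def field_simps)
  moreover have "p ^ Suc k * ppa_potential p (Suc k) b d =
      (real k + 2) * inner b b - 2 * (real k + 1) * inner b d
      + (real k + 1) * (2 * p - 1) / p * inner d d"
    using p by (simp add: ppa_potential_def add.commute)
  moreover have "(norm (d - p *\<^sub>R (2 *\<^sub>R b - a)))\<^sup>2 = inner d d + 4 * p\<^sup>2 * inner b b
      + p\<^sup>2 * inner a a - 4 * p * inner b d + 2 * p * inner a d - 4 * p\<^sup>2 * inner a b"
    unfolding power2_norm_eq_inner
    by (simp add: inner_diff_left inner_diff_right inner_commute power2_eq_square algebra_simps)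
  moreover have "inner (b - d) ((a - b) - (b - d)) =
      inner a b - 2 * inner b b + 3 * inner b d - inner a d - inner d d"
    by (simp add: inner_diff_left inner_diff_right inner_commute)
  moreover have "inner b (a - b) = inner a b - inner b b"
    by (simp add: inner_diff_right inner_commute)
  ultimately show ?thesis
    using p by (simp only: right_diff_distrib[of "p ^ Suc k"])
      (simp add: field_simps power2_eq_square)
qed

text \<open>The condition linking \<open>p\<close> and \<open>k\<close> is exactly nonnegativity of
  the coefficient of \<open>inner b (a - b)\<close> in the identity above; the other coefficients
  are positive anyway.\<close>

lemma ppa_potential_decreasing:
  fixes a b d :: "'a::real_inner"
  assumes p: "p > 0" "p * (real k + 2) \<ge> real k + 1"
    and zero: "inner b (a - b) \<ge> 0"
    and step: "inner (b - d) ((a - b) - (b - d)) \<ge> 0"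
  shows "ppa_potential p (Suc k) b d \<le> ppa_potential p k a b"
proof -
  have "p ^ Suc k * (ppa_potential p k a b - ppa_potential p (Suc k) b d) \<ge> 0"
    unfolding ppa_potential_diff[OF p(1)] using assms
    by (intro add_nonneg_nonneg mult_nonneg_nonneg) auto
  moreover have "p ^ Suc k > 0" using p(1) by simp
  ultimately show ?thesis
    by (simp only: zero_le_mult_iff) linarith
qed

text \<open>The operator enters only through these inequalities, with its zero moved to the origin
  and the step size absorbed. The case \<open>k = N\<close> of \<open>zero\<close> serves only to
  discard the remainder left after the last potential step.\<close>

lemma ppa_residual_bound:
  fixes w :: "nat \<Rightarrow> 'a::real_inner"
  assumes N: "N \<ge> 1"
    and zero: "\<And>k. k \<le> N \<Longrightarrow> inner (w (Suc k)) (w k - w (Suc k)) \<ge> 0"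
    and step: "\<And>k. k < N \<Longrightarrow> inner (w (Suc k) - w (Suc (Suc k)))
                   ((w k - w (Suc k)) - (w (Suc k) - w (Suc (Suc k)))) \<ge> 0"
  shows "(norm (w N - w (Suc N)))\<^sup>2
      \<le> 1 / (1 + 1 / real N) ^ N * (1 / (real N + 1)) * (norm (w 0))\<^sup>2"
proof -
  define p where "p = real N / (real N + 1)"
  have p: "p > 0" using N by (simp add: p_def)
  have "k \<le> N \<Longrightarrow> ppa_potential p k (w k) (w (Suc k)) \<le> (norm (w 0))\<^sup>2" for k
  proof (induction k)
    case 0
    then show ?case by (simp add: ppa_potential_def power2_norm_eq_inner)
  next
    case (Suc k)
    \<comment> \<open>For this \<open>p\<close> the inequality amounts to
      \<open>Suc k \<le> N\<close>, with equality at the last step.\<close>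
    have "p * (real k + 2) \<ge> real k + 1"
      using Suc.prems by (simp add: p_def field_simps)
    with Suc p show ?case
      using ppa_potential_decreasing[of p k "w (Suc k)" "w k" "w (Suc (Suc k))"] zero[of k] step[of k]
      by fastforce
  qed
  from this[of N] have "p ^ N * ppa_potential p N (w N) (w (Suc N)) \<le> p ^ N * (norm (w 0))\<^sup>2"
    using p by simp
  \<comment> \<open>With last coefficient \<open>N - 1\<close>, the form at \<open>k = N\<close>
    splits into the residual term and a multiple of the inner product in
    \<open>zero\<close>.\<close>
  moreover have "real N * (2 * p - 1) / p = real N - 1"
  proof -
    have "real N * (2 * p - 1) = (real N - 1) * p" using N by (simp add: p_def field_simps)
    with p show ?thesis by simp
  qed
  then have "p ^ N * ppa_potential p N (w N) (w (Suc N)) =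
      (real N + 1) * (norm (w N - w (Suc N)))\<^sup>2 + 2 * inner (w (Suc N)) (w N - w (Suc N))"
    using p by (simp add: ppa_potential_def)
      (simp add: power2_norm_eq_inner inner_diff_left inner_diff_right
        inner_commute[of "w (Suc N)" "w N"] algebra_simps)
  ultimately have "(real N + 1) * (norm (w N - w (Suc N)))\<^sup>2 \<le> p ^ N * (norm (w 0))\<^sup>2"
    using zero[of N] by simp
  moreover have "1 / (1 + 1 / real N) ^ N = p ^ N"
  proof -
    have "1 / (1 + 1 / real N) = p" using N by (simp add: p_def field_simps)
    then show ?thesis by (metis power_one_over)
  qed
  ultimately show ?thesis by (simp add: field_simps)
qed

lemma resolvent_singletonD:
  assumes "resolvent c A x = {y}"
  obtains u where "u \<in> A y" "x - y = c *\<^sub>R u"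
proof -
  have "y \<in> resolvent c A x" using assms by simp
  then obtain u where "u \<in> A y" "x = y + c *\<^sub>R u"
    by (auto simp: resolvent_def op_inverse_def)
  with that show thesis by simp
qed

lemma worst_case_residual_le:
  assumes N: "N \<ge> 1"
  shows "worst_case_residual TYPE('a::euclidean_space) N
           \<le> ereal (1 / (1 + 1 / real N) ^ N * (1 / (real N + 1)))"
  unfolding worst_case_residual_def
proof (intro Sup_least, clarsimp simp del: of_nat_Suc)
  fix A c and ws :: 'a and w :: "nat \<Rightarrow> 'a"
  assume A: "maximal_monotone_op A" and c: "c > 0" and ws: "0 \<in> A ws"
    and ne: "w 0 \<noteq> ws" and it: "ppa_iterates c A N w"
  have mono: "inner (x - x') (y - y') \<ge> 0" if "y \<in> A x" "y' \<in> A x'" for x x' y y'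
    using A that by (auto simp: maximal_monotone_op_def monotone_op_def)
  have ex: "\<exists>u. u \<in> A (w (Suc k)) \<and> w k - w (Suc k) = c *\<^sub>R u" if "k \<le> N" for k
    using it that resolvent_singletonD unfolding ppa_iterates_def by metis
  have "(norm ((w N - ws) - (w (Suc N) - ws)))\<^sup>2
      \<le> 1 / (1 + 1 / real N) ^ N * (1 / (real N + 1)) * (norm (w 0 - ws))\<^sup>2"
  proof (rule ppa_residual_bound[OF N])
    fix k assume "k \<le> N"
    then obtain u where u: "u \<in> A (w (Suc k))" "w k - w (Suc k) = c *\<^sub>R u" using ex by blast
    show "inner (w (Suc k) - ws) ((w k - ws) - (w (Suc k) - ws)) \<ge> 0"
      using mono[OF u(1) ws] u(2) c by simp
  next
    fix k assume "k < N"
    then obtain u v where u: "u \<in> A (w (Suc k))" "w k - w (Suc k) = c *\<^sub>R u"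
      and v: "v \<in> A (w (Suc (Suc k)))" "w (Suc k) - w (Suc (Suc k)) = c *\<^sub>R v"
      using ex[of k] ex[of "Suc k"] by auto
    have "c * inner (w (Suc k) - w (Suc (Suc k))) (u - v) \<ge> 0"
      using mono[OF u(1) v(1)] c by simp
    then show "inner ((w (Suc k) - ws) - (w (Suc (Suc k)) - ws))
      (((w k - ws) - (w (Suc k) - ws)) - ((w (Suc k) - ws) - (w (Suc (Suc k)) - ws))) \<ge> 0"
      by (simp add: u(2) v(2) inner_diff_right right_diff_distrib)
  qed
  with ne show "(norm (w N - w (Suc N)))\<^sup>2 / (norm (w 0 - ws))\<^sup>2
      \<le> 1 / ((1 + 1 / real N) ^ N * (real N + 1))"
    by (simp add: divide_le_eq)
qed

text \<open>Skewness turns the monotonicity inequality into an equality. For maximality, testing a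
  pair \<open>(x, y)\<close> of an extension against the graph points over \<open>x - h\<close>
  gives \<open>inner h (y - T x) \<ge> 0\<close> for every \<open>h\<close>, and
  \<open>h = - (y - T x)\<close> forces \<open>y = T x\<close>.\<close>

lemma maximal_monotone_op_skew:
  fixes T :: "'a::real_inner \<Rightarrow> 'a"
  assumes lin: "linear T" and skew: "\<And>x. inner x (T x) = 0"
  shows "maximal_monotone_op (\<lambda>x. {T x})"
  unfolding maximal_monotone_op_def
proof (intro conjI allI impI)
  show "monotone_op (\<lambda>x. {T x})"
    using skew by (simp add: monotone_op_def flip: linear_diff[OF lin])
next
  fix B :: "'a \<Rightarrow> 'a set" assume B: "monotone_op B"
  show "\<not> op_graph (\<lambda>x. {T x}) \<subset> op_graph B"
  proof
    assume sub: "op_graph (\<lambda>x. {T x}) \<subset> op_graph B"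
    have "y = T x" if y: "y \<in> B x" for x y
    proof -
      have TB: "T z \<in> B z" for z using sub by (auto simp: op_graph_def)
      have "inner h (y - T x) \<ge> 0" for h
      proof -
        have "inner (x - (x - h)) (y - T (x - h)) \<ge> 0"
          using B y TB unfolding monotone_op_def by blast
        then show ?thesis
          using skew[of h] by (simp add: linear_diff[OF lin] inner_diff_right)
      qed
      from this[of "- (y - T x)"] have "\<not> inner (y - T x) (y - T x) > 0"
        by (simp only: inner_minus_left)
      then show "y = T x" unfolding inner_gt_zero_iff by simp
    qed
    then have "op_graph B \<subseteq> op_graph (\<lambda>x. {T x})" by (auto simp: op_graph_def)
    with sub show False by blast
  qed
qed

text \<open>Uniqueness holds since the inner product of \<open>v\<close> with \<open>v + T v\<close>
  is \<open>inner v v\<close>, so the identity plus \<open>T\<close> is injective.\<close>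

lemma resolvent_skew_eq:
  fixes T :: "'a::real_inner \<Rightarrow> 'a"
  assumes lin: "linear T" and skew: "\<And>x. inner x (T x) = 0" and y: "y + T y = x"
  shows "resolvent 1 (\<lambda>x. {T x}) x = {y}"
proof -
  have "z = y" if "z + T z = x" for z
  proof -
    have "(z - y) + T (z - y) = (z + T z) - (y + T y)" by (simp add: linear_diff[OF lin])
    then have "(z - y) + T (z - y) = 0" using that y by simp
    then have "inner (z - y) (z - y) + inner (z - y) (T (z - y)) = 0"
      by (metis inner_add_right inner_zero_right)
    then show ?thesis using skew by simp
  qed
  then have "{z. z + T z = x} = {y}" using y by blast
  moreover have "resolvent 1 (\<lambda>x. {T x}) x = {z. z + T z = x}"
    by (auto simp: resolvent_def op_inverse_def)
  ultimately show ?thesis by simp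
qed

lemma worst_case_residual_ge:
  assumes N: "N \<ge> 1" and dim: "DIM('a::euclidean_space) \<ge> 2"
  shows "worst_case_residual TYPE('a) N
           \<ge> ereal (1 / (1 + 1 / real N) ^ N * (1 / (real N + 1)))"
proof -
  obtain b1 b2 :: 'a where b: "b1 \<in> Basis" "b2 \<in> Basis" "b1 \<noteq> b2"
    using dim by (meson card_2_iff' obtain_subset_with_card_n subset_iff)
  have ib [simp]: "inner b1 b1 = 1" "inner b2 b2 = 1" "inner b1 b2 = 0" "inner b2 b1 = 0"
    using b by (auto simp: inner_Basis)
  \<comment> \<open>Rotation scaled by \<open>t\<close> yields the ratio
    \<open>t\<^sup>2 / (1 + t\<^sup>2) ^ (N + 1)\<close>, which is largest at
    \<open>t\<^sup>2 = 1 / N\<close>.\<close>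
  define t where "t = 1 / sqrt (real N)"
  define p where "p = real N / (real N + 1)"
  have t2: "t * t = 1 / real N" by (simp add: t_def)
  have p: "p > 0" "p * (1 + t * t) = 1"
    using N unfolding p_def t2 by (simp, simp add: divide_simps)
  define T where "T x = t *\<^sub>R (inner x b1 *\<^sub>R b2 - inner x b2 *\<^sub>R b1)" for x
  have lin: "linear T"
    by (rule linearI) (simp_all add: T_def inner_add_left algebra_simps)
  have skew: "inner x (T x) = 0" for x by (simp add: T_def inner_diff_right)
  \<comment> \<open>On the plane of \<open>b1\<close> and \<open>b2\<close> the square of
    \<open>T\<close> is \<open>- (t * t)\<close> times the identity, so this map inverts the
    identity plus \<open>T\<close> there.\<close>
  define w where "w k = ((\<lambda>x. p *\<^sub>R (x - T x)) ^^ k) b1" for k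
  have w0: "w 0 = b1" and wS: "w (Suc k) = p *\<^sub>R (w k - T (w k))" for k by (simp_all add: w_def)
  \<comment> \<open>\<open>T\<close> vanishes on the orthogonal complement of the plane, so the
    formulas for \<open>T (T (w k))\<close> and the norm of \<open>T (w k)\<close> rely on the
    iterates staying in it.\<close>
  have plane: "w k = inner (w k) b1 *\<^sub>R b1 + inner (w k) b2 *\<^sub>R b2" for k
  proof (induction k)
    case 0
    show ?case by (simp add: w0)
  next
    case (Suc k)
    show ?case unfolding wS
      by (subst (1) Suc.IH) (simp add: T_def inner_diff_left algebra_simps)
  qed
  have TT: "T (T (w k)) = - (t * t) *\<^sub>R w k" for k
    by (subst (2) plane) (simp add: T_def inner_diff_left algebra_simps)
  have nT: "inner (T (w k)) (T (w k)) = t * t * inner (w k) (w k)" for k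
    by (subst (3) plane, subst (4) plane)
      (simp add: T_def inner_diff_left inner_diff_right inner_add_left inner_add_right algebra_simps)
  have retract: "w (Suc k) + T (w (Suc k)) = w k" for k
  proof -
    have "w (Suc k) + T (w (Suc k)) = p *\<^sub>R (w k - T (T (w k)))"
      by (simp add: wS linear_scale[OF lin] linear_diff[OF lin] algebra_simps)
    also have "\<dots> = (p * (1 + t * t)) *\<^sub>R w k" by (simp add: TT algebra_simps)
    finally show ?thesis using p by simp
  qed
  have nw: "inner (w k) (w k) = p ^ k" for k
  proof (induction k)
    case 0
    show ?case by (simp add: w0)
  next
    case (Suc k)
    have "inner (w (Suc k)) (w (Suc k)) = p * (p * (1 + t * t)) * inner (w k) (w k)"
      using skew[of "w k"]
      by (simp add: wS inner_diff_left inner_diff_right nT inner_commute algebra_simps)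
    then show ?case using p Suc.IH by simp
  qed
  have "w N - w (Suc N) = T (w (Suc N))" using retract[of N] by (simp add: algebra_simps)
  then have "(norm (w N - w (Suc N)))\<^sup>2 = t * t * p ^ Suc N"
    by (simp only: power2_norm_eq_inner nT nw)
  also have "\<dots> = p ^ N * (1 / (real N + 1))" using N by (simp add: t2 p_def)
  also have "p ^ N = 1 / (1 + 1 / real N) ^ N"
  proof -
    have "p = 1 / (1 + 1 / real N)" using N by (simp add: p_def field_simps)
    then show ?thesis by (metis power_one_over)
  qed
  finally have val: "(norm (w N - w (Suc N)))\<^sup>2 / (norm (w 0 - 0))\<^sup>2
      = 1 / (1 + 1 / real N) ^ N * (1 / (real N + 1))"
    by (simp add: w0 power2_norm_eq_inner)
  have T0: "T 0 = 0" by (simp add: T_def)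
  have "w 0 \<noteq> 0" using b by (auto simp: w0)
  moreover have "ppa_iterates 1 (\<lambda>x. {T x}) N w"
    using resolvent_skew_eq[OF lin skew retract] by (simp add: ppa_iterates_def)
  moreover have "op_inverse (\<lambda>x. {T x}) 0 \<noteq> {}" using T0 by (auto simp: op_inverse_def)
  ultimately show ?thesis
    unfolding worst_case_residual_def val[symmetric]
    using maximal_monotone_op_skew[OF lin skew] T0
    by (intro Sup_upper CollectI exI[of _ "\<lambda>x. {T x}"] exI[of _ "1::real"] exI[of _ "0::'a"]
        exI[of _ w]) simp
qed

theorem mainTheorem1:
  fixes N :: nat
  assumes "N \<ge> 1"
  shows "worst_case_residual TYPE('a::euclidean_space) N
           \<le> ereal (1 / (1 + 1 / real N) ^ N * (1 / (real N + 1)))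
         \<and> (DIM('a) \<ge> 2 \<longrightarrow>
             worst_case_residual TYPE('a) N
               = ereal (1 / (1 + 1 / real N) ^ N * (1 / (real N + 1))))"
  using worst_case_residual_le[OF assms, where ?'a = 'a]
    worst_case_residual_ge[OF assms, where ?'a = 'a]
  by (simp add: antisym)

end
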